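(* Let $f:\mathbb{Z}_N\to\mathbb{C}$ be nonzero, let $E,S\subset\mathbb{Z}_N$, and let $a,b\in(0,1)$. Suppose that $f$ is $L^2$-concentrated in $E$ at level $a$, in the sense that $$\|f\|_{L^2(E^c)}\le a\,\|f\|_{L^2(\mathbb{Z}_N)},$$ and that $\widehat f$ is $L^1$-concentrated on $S$ at level $b$, in the sense that $$\|\widehat f\|_{L^1(S^c)}\le b\,\|\widehat f\|_{L^1(\mathbb{Z}_N)}.$$ Then $$(1-a)^2\cdot\frac{N}{|E|}\ \le\ \mathrm{FR}(f)^2\ \le\ \frac{|S|}{(1-b)^2}.$$
   Context: $N$ is a positive integer and $\mathbb{Z}_N=\mathbb{Z}/N\mathbb{Z}$. For $f:\mathbb{Z}_N\to\mathbb{C}$ the unitary Fourier transform is $\widehat f(m)=N^{-1/2}\sum_{x\in\mathbb{Z}_N}e^{-2\pi i xm/N}f(x)$. For $A\subset\mathbb{Z}_N$, $\|g\|_{L^p(A)}=\left(\sum_{x\in A}|g(x)|^p\right)^{1/p}$ (counting measure), $\|g\|_p=\|g\|_{L^p(\mathbb{Z}_N)}$, and $A^c=\mathbb{Z}_N\setminus A$. The Fourier ratio of a nonzero $f$ is $\mathrm{FR}(f)=\|\widehat f\|_1/\|\widehat f\|_2$. *)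

theory Defs
  imports Complex_Main "HOL-Number_Theory.Residues"
begin

(* The carrier of residue_ring (int N) is {0..int N - 1}: each class of Z/NZ is given by its least
   nonnegative representative. A function on Z/NZ is an "int \<Rightarrow> complex" of which only
   the values on this carrier are ever used. *)
abbreviation Z_mod :: "nat \<Rightarrow> int set" where
  "Z_mod N \<equiv> carrier (residue_ring (int N))"

definition fourier :: "nat \<Rightarrow> (int \<Rightarrow> complex) \<Rightarrow> int \<Rightarrow> complex" where
  "fourier N f m = complex_of_real (1 / sqrt (real N)) *
     (\<Sum>x\<in>Z_mod N. exp (- (2 * complex_of_real pi * \<i> * of_int x * of_int m / of_nat N)) * f x)"

definition Lp_norm :: "real \<Rightarrow> int set \<Rightarrow> (int \<Rightarrow> complex) \<Rightarrow> real" where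
  "Lp_norm p A g = (\<Sum>x\<in>A. norm (g x) powr p) powr (1 / p)"

definition fourier_ratio :: "nat \<Rightarrow> (int \<Rightarrow> complex) \<Rightarrow> real" where
  "fourier_ratio N f = Lp_norm 1 (Z_mod N) (fourier N f) / Lp_norm 2 (Z_mod N) (fourier N f)"

end

theory Submission
  imports Defs "HOL-Analysis.Analysis"
begin

text \<open>
  By Fourier inversion every value of f is at most \<open>N\<^sup>-\<^sup>1\<^sup>/\<^sup>2\<close> times the \<open>L\<^sup>1\<close> norm of its transform, so
  that norm controls the \<open>L\<^sup>2\<close> mass of f on E, which by concentration is most of the \<open>L\<^sup>2\<close> norm of f;
  Plancherel turns this into the lower bound. The upper bound is Cauchy--Schwarz for the transform
  on S.
\<close>

text \<open>Taking all integers as arguments lets products and differences of representatives be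
  used without reduction modulo \<open>N\<close>. The sign is positive, so the kernel of
  \<open>fourier\<close> is \<open>root_char N (- (x * m))\<close>.\<close>

definition root_char :: "nat \<Rightarrow> int \<Rightarrow> complex" where
  "root_char N k = cis (2 * pi * of_int k / real N)"

lemma root_char_add: "root_char N (j + k) = root_char N j * root_char N k"
  by (simp add: root_char_def cis_mult distrib_left add_divide_distrib)

lemma root_char_mult_nat: "root_char N (k * int m) = root_char N k ^ m"
  by (induction m) (simp_all add: root_char_add distrib_left, simp add: root_char_def)

lemma root_char_eq_1_iff:
  assumes "N > 0"
  shows "root_char N k = 1 \<longleftrightarrow> int N dvd k"
proof
  assume "root_char N k = 1"
  then have "cos (2 * pi * of_int k / real N) = 1"
    by (simp add: root_char_def complex_eq_iff)
  then obtain j :: int where "2 * pi * of_int k / real N = of_int j * 2 * pi"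
    by (auto simp: cos_one_2pi_int)
  then have "real_of_int k = of_int (j * int N)"
    using assms by (simp add: field_simps)
  then have "k = j * int N"
    by (simp only: of_int_eq_iff)
  then show "int N dvd k" by simp
next
  assume "int N dvd k"
  then obtain j where "k = int N * j" ..
  then show "root_char N k = 1"
    using assms cis_multiple_2pi[of "of_int j"] by (simp add: root_char_def mult.assoc)
qed

lemma Z_mod_eq: "Z_mod N = {0..<int N}"
  by (auto simp: residue_ring_def)

lemma Z_mod_eq_image: "Z_mod N = int ` {..<N}"
  by (simp add: Z_mod_eq lessThan_atLeast0 image_int_atLeastLessThan)

lemma finite_Z_mod [simp]: "finite (Z_mod N)"
  by (simp add: Z_mod_eq)

text \<open>Orthogonality of characters: this is a geometric sum whose ratio is an
  \<open>N\<close>-th root of unity, and the ratio is 1 exactly when \<open>N\<close> divides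
  \<open>k\<close>.\<close>

lemma sum_root_char:
  assumes "N > 0"
  shows "(\<Sum>m\<in>Z_mod N. root_char N (k * m)) = (if int N dvd k then of_nat N else 0)"
proof -
  have "(\<Sum>m\<in>Z_mod N. root_char N (k * m)) = (\<Sum>m<N. root_char N k ^ m)"
    by (simp add: Z_mod_eq_image sum.reindex root_char_mult_nat)
  moreover have "root_char N k ^ N = 1"
    using assms by (simp add: root_char_eq_1_iff flip: root_char_mult_nat)
  ultimately show ?thesis
    using assms root_char_eq_1_iff[OF assms, of k] by (auto simp: geometric_sum)
qed

lemma sum_root_char_diff:
  assumes "x \<in> Z_mod N" "y \<in> Z_mod N"
  shows "(\<Sum>m\<in>Z_mod N. root_char N ((x - y) * m)) = (if y = x then of_nat N else 0)"
proof -
  have "N > 0"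
    using assms by (auto simp: Z_mod_eq)
  \<comment> \<open>Both representatives lie in \<open>{0..<int N}\<close>, so their difference is
    smaller than \<open>N\<close> in absolute value and is divisible by \<open>N\<close> only if it
    vanishes.\<close>
  moreover have "int N dvd x - y \<longleftrightarrow> y = x"
    using assms zdvd_not_zless[of "\<bar>x - y\<bar>" "int N"] by (fastforce simp: Z_mod_eq)
  ultimately show ?thesis
    by (simp add: sum_root_char)
qed

lemma fourier_eq:
  "fourier N f m = (\<Sum>x\<in>Z_mod N. root_char N (- (x * m)) * f x) / of_real (sqrt (real N))"
  by (simp add: fourier_def root_char_def cis_conv_exp mult_ac)

text \<open>After the two sums are exchanged, orthogonality leaves only the term
  \<open>y = x\<close>. The factor is the square root of \<open>N\<close> because the unitary
  normalisation divides the \<open>N\<close> from orthogonality by that root.\<close>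

lemma fourier_inversion:
  assumes "x \<in> Z_mod N"
  shows "(\<Sum>m\<in>Z_mod N. root_char N (x * m) * fourier N f m) = of_real (sqrt (real N)) * f x"
proof -
  have N: "N > 0"
    using assms by (auto simp: Z_mod_eq)
  let ?s = "complex_of_real (sqrt (real N))"
  have s: "of_nat N = ?s * ?s"
    by (simp flip: of_real_mult)
  have "(\<Sum>m\<in>Z_mod N. root_char N (x * m) * fourier N f m)
      = (\<Sum>m\<in>Z_mod N. \<Sum>y\<in>Z_mod N. root_char N ((x - y) * m) * f y) / ?s"
    by (simp add: fourier_eq sum_divide_distrib sum_distrib_left left_diff_distrib mult.assoc
        flip: root_char_add mult.assoc[of "root_char _ _"])
  also have "\<dots> = (\<Sum>y\<in>Z_mod N. (\<Sum>m\<in>Z_mod N. root_char N ((x - y) * m)) * f y) / ?s"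
    by (subst sum.swap) (simp add: sum_distrib_right)
  also have "\<dots> = (\<Sum>y\<in>Z_mod N. if y = x then of_nat N * f x else 0) / ?s"
    using assms
    by (intro arg_cong2[where f = "(/)"] sum.cong) (auto simp: sum_root_char_diff)
  also have "\<dots> = of_nat N * f x / ?s"
    using assms by simp
  also have "\<dots> = ?s * f x"
    using N by (simp add: s)
  finally show ?thesis .
qed

text \<open>Only one of the two factors in the squared modulus is expanded; the sum over
  \<open>m\<close> of what remains is then evaluated by the inversion formula.\<close>

lemma plancherel:
  assumes "N > 0"
  shows "(\<Sum>m\<in>Z_mod N. (norm (fourier N f m))\<^sup>2) = (\<Sum>x\<in>Z_mod N. (norm (f x))\<^sup>2)"
proof -
  let ?s = "complex_of_real (sqrt (real N))"
  have "complex_of_real (\<Sum>m\<in>Z_mod N. (norm (fourier N f m))\<^sup>2)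
      = (\<Sum>m\<in>Z_mod N. fourier N f m * cnj (fourier N f m))"
    by (simp add: complex_norm_square del: of_real_power)
  also have "\<dots> = (\<Sum>m\<in>Z_mod N. \<Sum>x\<in>Z_mod N. cnj (f x) * (root_char N (x * m) * fourier N f m)) / ?s"
    \<comment> \<open>The conjugated factor is the one expanded: conjugation turns
      \<open>root_char N (- (x * m))\<close> into \<open>root_char N (x * m)\<close>, the kernel of
      the inversion formula.\<close>
    by (subst (2) fourier_eq)
      (simp add: root_char_def cis_cnj sum_divide_distrib sum_distrib_left mult_ac)
  also have "\<dots> = (\<Sum>x\<in>Z_mod N. cnj (f x) * (\<Sum>m\<in>Z_mod N. root_char N (x * m) * fourier N f m)) / ?s"
    by (subst sum.swap) (simp add: sum_distrib_left)
  also have "\<dots> = (\<Sum>x\<in>Z_mod N. cnj (f x) * (?s * f x)) / ?s"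
    by (simp add: fourier_inversion)
  also have "\<dots> = complex_of_real (\<Sum>x\<in>Z_mod N. (norm (f x))\<^sup>2)"
    using assms by (simp add: complex_norm_square sum_divide_distrib mult_ac del: of_real_power)
  finally show ?thesis
    by (simp only: of_real_eq_iff)
qed

lemma Lp_norm_nonneg: "0 \<le> Lp_norm p A g"
  by (simp add: Lp_norm_def)

lemma Lp_norm_1: "Lp_norm 1 A g = (\<Sum>x\<in>A. norm (g x))"
  by (simp add: Lp_norm_def sum_nonneg)

lemma Lp_norm_2: "Lp_norm 2 A g = sqrt (\<Sum>x\<in>A. (norm (g x))\<^sup>2)"
  by (simp add: Lp_norm_def powr_half_sqrt sum_nonneg)

lemma Lp_norm_2_squared: "(Lp_norm 2 A g)\<^sup>2 = (\<Sum>x\<in>A. (norm (g x))\<^sup>2)"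
  by (simp add: Lp_norm_2 sum_nonneg)

text \<open>The triangle inequality applied to the inversion formula, since characters have modulus
  1.\<close>

lemma norm_le_Lp_norm_1_fourier:
  assumes "x \<in> Z_mod N"
  shows "real N * (norm (f x))\<^sup>2 \<le> (Lp_norm 1 (Z_mod N) (fourier N f))\<^sup>2"
proof -
  have "sqrt (real N) * norm (f x) = norm (\<Sum>m\<in>Z_mod N. root_char N (x * m) * fourier N f m)"
    using assms by (simp add: fourier_inversion norm_mult)
  also have "\<dots> \<le> Lp_norm 1 (Z_mod N) (fourier N f)"
    unfolding Lp_norm_1 by (rule sum_norm_le) (simp add: norm_mult root_char_def)
  finally have "(sqrt (real N) * norm (f x))\<^sup>2 \<le> (Lp_norm 1 (Z_mod N) (fourier N f))\<^sup>2"
    by (intro power_mono) auto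
  then show ?thesis
    by (simp add: power_mult_distrib)
qed

text \<open>The complement of \<open>E\<close> carries at most the share \<open>a\<^sup>2\<close> of
  the squared norm, so \<open>E\<close> carries at least \<open>1 - a\<^sup>2\<close>. The pointwise
  bound, summed over \<open>E\<close>, limits that mass from above.\<close>

lemma Lp_norm_2_le_Lp_norm_1_fourier:
  assumes "E \<subseteq> Z_mod N" "0 < a" "a < 1"
    and conc: "Lp_norm 2 (Z_mod N - E) f \<le> a * Lp_norm 2 (Z_mod N) f"
  shows "(1 - a)\<^sup>2 * real N * (Lp_norm 2 (Z_mod N) f)\<^sup>2
    \<le> real (card E) * (Lp_norm 1 (Z_mod N) (fourier N f))\<^sup>2"
proof -
  have "(Lp_norm 2 (Z_mod N) f)\<^sup>2 = (Lp_norm 2 (Z_mod N - E) f)\<^sup>2 + (Lp_norm 2 E f)\<^sup>2"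
    using assms(1) by (simp add: Lp_norm_2_squared sum.subset_diff)
  moreover have "(Lp_norm 2 (Z_mod N - E) f)\<^sup>2 \<le> a\<^sup>2 * (Lp_norm 2 (Z_mod N) f)\<^sup>2"
    using power_mono[OF conc Lp_norm_nonneg] by (simp add: power_mult_distrib)
  \<comment> \<open>Here the constant \<open>1 - a\<^sup>2\<close> is weakened to the one in the
    theorem; this amounts to \<open>a * a \<le> a\<close>.\<close>
  moreover have "(1 - a)\<^sup>2 * (Lp_norm 2 (Z_mod N) f)\<^sup>2 \<le> (1 - a\<^sup>2) * (Lp_norm 2 (Z_mod N) f)\<^sup>2"
  proof (rule mult_right_mono)
    have "a * a \<le> a" using assms by (intro mult_left_le) auto
    then show "(1 - a)\<^sup>2 \<le> 1 - a\<^sup>2" by (simp add: power2_eq_square algebra_simps)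
  qed simp
  ultimately have "(1 - a)\<^sup>2 * (Lp_norm 2 (Z_mod N) f)\<^sup>2 \<le> (Lp_norm 2 E f)\<^sup>2"
    by (simp add: left_diff_distrib)
  then have "real N * ((1 - a)\<^sup>2 * (Lp_norm 2 (Z_mod N) f)\<^sup>2) \<le> real N * (Lp_norm 2 E f)\<^sup>2"
    by (rule mult_left_mono) simp
  also have "\<dots> = (\<Sum>x\<in>E. real N * (norm (f x))\<^sup>2)"
    by (simp add: Lp_norm_2_squared sum_distrib_left)
  also have "\<dots> \<le> real (card E) * (Lp_norm 1 (Z_mod N) (fourier N f))\<^sup>2"
    using assms(1) by (intro sum_bounded_above norm_le_Lp_norm_1_fourier) auto
  finally show ?thesis
    by (simp add: mult_ac)
qed

text \<open>\<open>S\<close> carries at least the share \<open>1 - b\<close> of the sum of moduli.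
  Cauchy-Schwarz against the constant 1 on \<open>S\<close> produces \<open>card S\<close>, and the
  sum of squares then grows from \<open>S\<close> to \<open>A\<close>.\<close>

lemma Lp_norm_1_le_Lp_norm_2:
  assumes "finite A" "S \<subseteq> A" "b < 1"
    and conc: "Lp_norm 1 (A - S) g \<le> b * Lp_norm 1 A g"
  shows "(1 - b)\<^sup>2 * (Lp_norm 1 A g)\<^sup>2 \<le> real (card S) * (Lp_norm 2 A g)\<^sup>2"
proof -
  have "Lp_norm 1 A g = Lp_norm 1 (A - S) g + Lp_norm 1 S g"
    using assms(1,2) by (simp add: Lp_norm_1 sum.subset_diff)
  with conc have "(1 - b) * Lp_norm 1 A g \<le> Lp_norm 1 S g"
    by (simp add: left_diff_distrib)
  then have "((1 - b) * Lp_norm 1 A g)\<^sup>2 \<le> (Lp_norm 1 S g)\<^sup>2"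
    using assms(3) by (intro power_mono) (auto simp: Lp_norm_nonneg)
  also have "\<dots> \<le> (\<Sum>x\<in>S. (norm (g x))\<^sup>2) * real (card S)"
    unfolding Lp_norm_1 by (rule sum_squared_le_sum_of_squares)
  also have "\<dots> \<le> (\<Sum>x\<in>A. (norm (g x))\<^sup>2) * real (card S)"
    using assms(1,2) by (intro mult_right_mono sum_mono2) auto
  finally show ?thesis
    by (simp add: power_mult_distrib Lp_norm_2_squared mult.commute)
qed

theorem theorem1p8:
  fixes N :: nat and f :: "int \<Rightarrow> complex" and E S :: "int set" and a b :: real
  assumes "N > 0"
    and "\<exists>x\<in>Z_mod N. f x \<noteq> 0"
    and "E \<subseteq> Z_mod N" and "S \<subseteq> Z_mod N"
    and "a \<in> {0<..<1}" and "b \<in> {0<..<1}"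
    and "Lp_norm 2 (Z_mod N - E) f \<le> a * Lp_norm 2 (Z_mod N) f"
    and "Lp_norm 1 (Z_mod N - S) (fourier N f) \<le> b * Lp_norm 1 (Z_mod N) (fourier N f)"
  shows "(1 - a)\<^sup>2 * (real N / real (card E)) \<le> (fourier_ratio N f)\<^sup>2
    \<and> (fourier_ratio N f)\<^sup>2 \<le> real (card S) / (1 - b)\<^sup>2"
proof -
  let ?n1 = "Lp_norm 1 (Z_mod N) (fourier N f)" and ?n2 = "Lp_norm 2 (Z_mod N) (fourier N f)"
  have eq: "(Lp_norm 2 (Z_mod N) f)\<^sup>2 = ?n2\<^sup>2"
    using plancherel[OF \<open>N > 0\<close>] by (simp add: Lp_norm_2_squared)
  \<comment> \<open>A nonzero value of \<open>f\<close> makes its norm positive; Plancherel passes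
    this on to \<open>?n2\<close>, the denominator of the Fourier ratio.\<close>
  have "(Lp_norm 2 (Z_mod N) f)\<^sup>2 > 0"
    unfolding Lp_norm_2_squared using assms(2) by (auto intro: sum_pos2)
  then have pos: "?n2\<^sup>2 > 0"
    by (simp only: eq)
  have low: "(1 - a)\<^sup>2 * real N * ?n2\<^sup>2 \<le> real (card E) * ?n1\<^sup>2"
    using Lp_norm_2_le_Lp_norm_1_fourier[of E N a f] assms by (simp add: eq)
  have up: "(1 - b)\<^sup>2 * ?n1\<^sup>2 \<le> real (card S) * ?n2\<^sup>2"
    using Lp_norm_1_le_Lp_norm_2[of "Z_mod N" S b "fourier N f"] assms by simp
  \<comment> \<open>An empty \<open>E\<close> would make the right side of \<open>low\<close> zero.
    Positivity of the left side excludes this, so \<open>card E\<close> may be cleared as a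
    denominator.\<close>
  have "0 < (1 - a)\<^sup>2 * real N * ?n2\<^sup>2"
    using assms pos by simp
  with low have "card E > 0"
    by (cases "card E = 0") auto
  then have "(1 - a)\<^sup>2 * (real N / real (card E)) \<le> ?n1\<^sup>2 / ?n2\<^sup>2"
    using low pos by (simp add: divide_simps mult_ac)
  moreover have "?n1\<^sup>2 / ?n2\<^sup>2 \<le> real (card S) / (1 - b)\<^sup>2"
    using up pos assms by (simp add: divide_simps mult_ac)
  ultimately show ?thesis
    by (simp add: fourier_ratio_def power_divide)
qed

end
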